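(* Let $(X,d,\preccurlyeq)$ be a sequentially increasingly right $K$-complete preordered quasi-metric space and let $\varphi:X\to\mathbb{R}\cup\{\infty\}$ be a proper, bounded below, increasingly lsc function. Suppose that for every sequence $(x_n)_{n\in\mathbb{N}}$ in $X$ and every $x\in X$: if $x_n\preccurlyeq x_{n+1}$ for all $n\in\mathbb{N}$ and $x_n\xrightarrow{d}x$, then $x_n\preccurlyeq x$ for all $n\in\mathbb{N}$. For $x\in X$ put $S(x)=\{y\in X: x\preccurlyeq y \text{ and } \varphi(y)+d(y,x)\le\varphi(x)\}$. Then there exists $z\in\operatorname{dom}\varphi$ such that $$\varphi(y)=\varphi(z)\quad\text{for all } y\in S(z).$$ In this case it follows that, for every $y\in S(z)$: (i) $S(y)\subseteq\overline{\{y\}}$; and (ii) $\varphi(y)<\varphi(x)+d(x,y)$ for all $x\in\operatorname{dom}\varphi\setminus S(y)$ with $y\preccurlyeq x$, and for all $x\in X\setminus\operatorname{dom}\varphi$.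
   Context: A quasi-metric on a set $X$ is a map $d:X\times X\to[0,\infty)$ with $d(x,x)=0$, $d(x,z)\le d(x,y)+d(y,z)$, and $d(x,y)=d(y,x)=0\Rightarrow x=y$ (symmetry is not required). The topology $\tau_d$ is generated by the balls $B_d(x,r)=\{y: d(x,y)<r\}$; all topological notions refer to $\tau_d$. Thus $x_n\xrightarrow{d}x$ means $d(x,x_n)\to0$, and $\overline{A}$ is the $\tau_d$-closure (so $y\in\overline{\{x\}}$ iff $d(y,x)=0$). A preordered quasi-metric space $(X,d,\preccurlyeq)$ is a quasi-metric space with a reflexive and transitive relation $\preccurlyeq$. A sequence is increasing if $x_n\preccurlyeq x_{n+1}$ for all $n$. A sequence is right $K$-Cauchy if for every $\varepsilon>0$ there is $n_\varepsilon$ such that $d(x_m,x_n)<\varepsilon$ whenever $n_\varepsilon\le n<m$. The space is sequentially increasingly right $K$-complete if every increasing right $K$-Cauchy sequence is convergent (with respect to $\tau_d$). For $\varphi:X\to\mathbb{R}\cup\{\infty\}$, $\operatorname{dom}\varphi=\{x:\varphi(x)<\infty\}$; $\varphi$ is proper if $\operatorname{dom}\varphi\ne\emptyset$; $\varphi$ is increasingly lsc if $\varphi(x)\le\liminf_n\varphi(x_n)$ for every increasing sequence $(x_n)$ with $x_n\xrightarrow{d}x$. *)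

theory Defs
  imports "HOL-Analysis.Analysis"
begin

locale quasi_metric_space =
  fixes X :: "'a set" and d :: "'a \<Rightarrow> 'a \<Rightarrow> real"
  assumes nonneg: "\<lbrakk>x \<in> X; y \<in> X\<rbrakk> \<Longrightarrow> 0 \<le> d x y"
    and self_zero: "x \<in> X \<Longrightarrow> d x x = 0"
    and triangle: "\<lbrakk>x \<in> X; y \<in> X; z \<in> X\<rbrakk> \<Longrightarrow> d x z \<le> d x y + d y z"
    and separated: "\<lbrakk>x \<in> X; y \<in> X; d x y = 0; d y x = 0\<rbrakk> \<Longrightarrow> x = y"

locale preordered_quasi_metric_space = quasi_metric_space X d
  for X :: "'a set" and d :: "'a \<Rightarrow> 'a \<Rightarrow> real" +
  fixes le :: "'a \<Rightarrow> 'a \<Rightarrow> bool"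
  assumes reflp_on_le: "reflp_on X le"
    and transp_on_le: "transp_on X le"

definition qball :: "'a set \<Rightarrow> ('a \<Rightarrow> 'a \<Rightarrow> real) \<Rightarrow> 'a \<Rightarrow> real \<Rightarrow> 'a set" where
  "qball X d x r = {y \<in> X. d x y < r}"

definition qtopology :: "'a set \<Rightarrow> ('a \<Rightarrow> 'a \<Rightarrow> real) \<Rightarrow> 'a topology" where
  "qtopology X d = topology_generated_by {qball X d x r | x r. x \<in> X \<and> 0 < r}"

definition increasing_seq :: "('a \<Rightarrow> 'a \<Rightarrow> bool) \<Rightarrow> (nat \<Rightarrow> 'a) \<Rightarrow> bool" where
  "increasing_seq le s \<longleftrightarrow> (\<forall>n. le (s n) (s (Suc n)))"

text \<open>The later point is the first argument of \<open>d\<close>; exchanging the arguments would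
  give left $K$-Cauchy sequences.\<close>

definition right_K_Cauchy :: "('a \<Rightarrow> 'a \<Rightarrow> real) \<Rightarrow> (nat \<Rightarrow> 'a) \<Rightarrow> bool" where
  "right_K_Cauchy d s \<longleftrightarrow>
     (\<forall>\<epsilon>>0. \<exists>N. \<forall>n m. N \<le> n \<and> n < m \<longrightarrow> d (s m) (s n) < \<epsilon>)"

definition seq_incr_right_K_complete ::
    "'a set \<Rightarrow> ('a \<Rightarrow> 'a \<Rightarrow> real) \<Rightarrow> ('a \<Rightarrow> 'a \<Rightarrow> bool) \<Rightarrow> bool" where
  "seq_incr_right_K_complete X d le \<longleftrightarrow>
     (\<forall>s. range s \<subseteq> X \<and> increasing_seq le s \<and> right_K_Cauchy d s
        \<longrightarrow> (\<exists>x. limitin (qtopology X d) s x sequentially))"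

definition edom :: "'a set \<Rightarrow> ('a \<Rightarrow> ereal) \<Rightarrow> 'a set" where
  "edom X \<phi> = {x \<in> X. \<phi> x < \<infinity>}"

definition incr_lsc ::
    "'a set \<Rightarrow> ('a \<Rightarrow> 'a \<Rightarrow> real) \<Rightarrow> ('a \<Rightarrow> 'a \<Rightarrow> bool) \<Rightarrow> ('a \<Rightarrow> ereal) \<Rightarrow> bool" where
  "incr_lsc X d le \<phi> \<longleftrightarrow>
     (\<forall>s x. range s \<subseteq> X \<and> increasing_seq le s \<and> limitin (qtopology X d) s x sequentially
        \<longrightarrow> \<phi> x \<le> liminf (\<lambda>n. \<phi> (s n)))"

definition Sset ::
    "'a set \<Rightarrow> ('a \<Rightarrow> 'a \<Rightarrow> real) \<Rightarrow> ('a \<Rightarrow> 'a \<Rightarrow> bool) \<Rightarrow> ('a \<Rightarrow> ereal) \<Rightarrow> 'a \<Rightarrow> 'a set" where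
  "Sset X d le \<phi> x = {y \<in> X. le x y \<and> \<phi> y + ereal (d y x) \<le> \<phi> x}"

context quasi_metric_space
begin

lemma topspace_qtopology: "topspace (qtopology X d) = X"
proof -
  have "x \<in> qball X d x 1" if "x \<in> X" for x
    using that self_zero by (simp add: qball_def)
  then have "X \<subseteq> \<Union>{qball X d x r | x r. x \<in> X \<and> 0 < r}"
    using zero_less_one by blast
  moreover have "\<Union>{qball X d x r | x r. x \<in> X \<and> 0 < r} \<subseteq> X"
    by (auto simp: qball_def)
  ultimately show ?thesis
    unfolding qtopology_def topology_generated_by_topspace by blast
qed

lemma openin_qball: "\<lbrakk>x \<in> X; 0 < r\<rbrakk> \<Longrightarrow> openin (qtopology X d) (qball X d x r)"
  unfolding qtopology_def by (rule topology_generated_by_Basis) auto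

lemma openin_qtopology:
  "openin (qtopology X d) U \<longleftrightarrow> U \<subseteq> X \<and> (\<forall>x\<in>U. \<exists>r>0. qball X d x r \<subseteq> U)"
proof
  assume U: "openin (qtopology X d) U"
  have "\<forall>x\<in>U. \<exists>r>0. qball X d x r \<subseteq> U"
    using U unfolding qtopology_def openin_topology_generated_by_iff
  proof (induction rule: generate_topology_on.induct)
    case (Int A B)
    show ?case
    proof
      fix x assume "x \<in> A \<inter> B"
      with Int.IH obtain r q where "r > 0" "qball X d x r \<subseteq> A" "q > 0" "qball X d x q \<subseteq> B"
        by blast
      then show "\<exists>r>0. qball X d x r \<subseteq> A \<inter> B"
        by (intro exI[of _ "min r q"]) (auto simp: qball_def)
    qed
  next
    case (UN K)
    then show ?case by (meson Union_iff Union_upper subset_trans)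
  next
    case (Basis B)
    then obtain c r where B: "c \<in> X" "B = qball X d c r" by blast
    show ?case
    proof
      fix x assume x: "x \<in> B"
      have "d c y < r" if "y \<in> X" "d x y < r - d c x" for y
        using triangle[OF B(1) _ that(1), of x] x B that(2) by (simp add: qball_def)
      then have "qball X d x (r - d c x) \<subseteq> B"
        using B by (auto simp: qball_def)
      then show "\<exists>r>0. qball X d x r \<subseteq> B"
        using x B by (intro exI[of _ "r - d c x"]) (auto simp: qball_def)
    qed
  qed auto
  then show "U \<subseteq> X \<and> (\<forall>x\<in>U. \<exists>r>0. qball X d x r \<subseteq> U)"
    using openin_subset[OF U] topspace_qtopology by blast
next
  assume U: "U \<subseteq> X \<and> (\<forall>x\<in>U. \<exists>r>0. qball X d x r \<subseteq> U)"
  have "\<exists>T. openin (qtopology X d) T \<and> x \<in> T \<and> T \<subseteq> U" if x: "x \<in> U" for x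
  proof -
    obtain r where "r > 0" "qball X d x r \<subseteq> U" using U x by blast
    moreover have "x \<in> X" using U x by blast
    ultimately show ?thesis
      using openin_qball self_zero by (intro exI[of _ "qball X d x r"]) (auto simp: qball_def)
  qed
  then show "openin (qtopology X d) U" by (subst openin_subopen) blast
qed

lemma limitin_qtopology:
  assumes "range s \<subseteq> X"
  shows "limitin (qtopology X d) s x sequentially \<longleftrightarrow> x \<in> X \<and> (\<lambda>n. d x (s n)) \<longlonglongrightarrow> 0"
proof -
  have s: "s n \<in> X" for n using assms by blast
  have "(\<forall>U. openin (qtopology X d) U \<and> x \<in> U \<longrightarrow> (\<forall>\<^sub>F n in sequentially. s n \<in> U))
      \<longleftrightarrow> (\<lambda>n. d x (s n)) \<longlonglongrightarrow> 0" (is "?L \<longleftrightarrow> ?R") if x: "x \<in> X"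
  proof
    assume L: ?L
    have "\<forall>\<^sub>F n in sequentially. dist (d x (s n)) 0 < e" if "e > 0" for e
    proof -
      have "x \<in> qball X d x e" using x that self_zero by (simp add: qball_def)
      then have "\<forall>\<^sub>F n in sequentially. s n \<in> qball X d x e"
        using L openin_qball[OF x that] by blast
      then show ?thesis
        by eventually_elim (use nonneg[OF x s] in \<open>simp add: qball_def\<close>)
    qed
    then show ?R by (simp add: tendsto_iff)
  next
    assume R: ?R
    show ?L
    proof (intro allI impI)
      fix U assume "openin (qtopology X d) U \<and> x \<in> U"
      then obtain r where r: "r > 0" "qball X d x r \<subseteq> U" using openin_qtopology by blast
      have "\<forall>\<^sub>F n in sequentially. d x (s n) < r" using R r(1) by (rule order_tendstoD)
      then show "\<forall>\<^sub>F n in sequentially. s n \<in> U"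
        by eventually_elim (use r s in \<open>auto simp: qball_def\<close>)
    qed
  qed
  then show ?thesis by (auto simp: limitin_def topspace_qtopology)
qed

lemma closure_of_singleton_qtopology:
  assumes "y \<in> X"
  shows "qtopology X d closure_of {y} = {w \<in> X. d w y = 0}"
proof (intro equalityI subsetI)
  fix w assume w: "w \<in> qtopology X d closure_of {y}"
  then have wX: "w \<in> X" by (simp add: in_closure_of topspace_qtopology)
  have lt: "d w y < r" if "r > 0" for r
  proof -
    have "w \<in> qball X d w r" using wX self_zero that by (simp add: qball_def)
    then have "y \<in> qball X d w r"
      using w openin_qball[OF wX that] unfolding in_closure_of by blast
    then show ?thesis by (simp add: qball_def)
  qed
  have "d w y \<le> 0" using lt[of "d w y"] by linarith
  with nonneg[OF wX assms] wX show "w \<in> {w \<in> X. d w y = 0}" by simp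
next
  fix w assume w: "w \<in> {w \<in> X. d w y = 0}"
  have "y \<in> T" if wT: "w \<in> T" and T: "openin (qtopology X d) T" for T
  proof -
    obtain r where "r > 0" "qball X d w r \<subseteq> T"
      using wT T[unfolded openin_qtopology] by blast
    moreover have "y \<in> qball X d w r" using w assms \<open>r > 0\<close> by (simp add: qball_def)
    ultimately show ?thesis by blast
  qed
  then show "w \<in> qtopology X d closure_of {y}"
    using w unfolding in_closure_of topspace_qtopology by blast
qed

end

end

theory Submission
  imports Defs
begin

text \<open>
  A Picard-type iteration: choose \<open>x\<^bsub>n+1\<^esub> \<in> S(x\<^sub>n)\<close> with \<open>\<phi>(x\<^bsub>n+1\<^esub>)\<close> close to
  \<open>inf \<phi>(S(x\<^sub>n))\<close>. The sets \<open>S(x\<^sub>n)\<close> decrease, so \<open>d(x\<^sub>m, x\<^sub>n) \<le> \<phi>(x\<^sub>n) - \<phi>(x\<^sub>m)\<close> for \<open>n \<le> m\<close>,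
  which makes the sequence right \<open>K\<close>-Cauchy because \<open>\<phi>(x\<^sub>n)\<close> decreases to some real \<open>L\<close>.
  Its limit \<open>z\<close> lies in every \<open>S(x\<^sub>n)\<close>; hence \<open>S(z) \<subseteq> S(x\<^sub>n)\<close> for all \<open>n\<close>, and the choice of \<open>x\<^bsub>n+1\<^esub>\<close>
  leaves no room for \<open>\<phi>\<close> on \<open>S(z)\<close> below \<open>L \<ge> \<phi>(z)\<close>.
\<close>

lemma (in preordered_quasi_metric_space) Sset_self:
  "x \<in> X \<Longrightarrow> x \<in> Sset X d le \<phi> x"
  using reflp_on_le by (auto simp: Sset_def self_zero reflp_on_def zero_ereal_def[symmetric])

text \<open>Transitivity of \<open>le\<close> handles the order condition. For the other one, the
  triangle inequality splits \<open>d w x\<close> through \<open>y\<close>, and the inequalities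
  defining the two memberships are chained.\<close>

lemma (in preordered_quasi_metric_space) Sset_mono:
  assumes x: "x \<in> X" and y: "y \<in> Sset X d le \<phi> x"
  shows "Sset X d le \<phi> y \<subseteq> Sset X d le \<phi> x"
proof
  fix w assume w: "w \<in> Sset X d le \<phi> y"
  have X: "w \<in> X" "y \<in> X" using w y by (auto simp: Sset_def)
  have "le x w"
    using w y X x transp_on_le unfolding Sset_def by (auto dest: transp_onD)
  moreover have "\<phi> w + ereal (d w x) \<le> \<phi> x"
  proof -
    have "\<phi> w + ereal (d w x) \<le> \<phi> w + ereal (d w y + d y x)"
      using triangle[OF X x] by (intro add_left_mono) simp
    also have "\<dots> = (\<phi> w + ereal (d w y)) + ereal (d y x)"
      by (simp add: add.assoc flip: plus_ereal.simps(1))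
    also have "\<dots> \<le> \<phi> y + ereal (d y x)"
      using w by (intro add_right_mono) (simp add: Sset_def)
    also have "\<dots> \<le> \<phi> x" using y by (simp add: Sset_def)
    finally show ?thesis .
  qed
  ultimately show "w \<in> Sset X d le \<phi> x" using X by (simp add: Sset_def)
qed

lemma edom_eq_ereal:
  assumes "x \<in> edom X \<phi>" "\<phi> x \<noteq> -\<infinity>"
  shows "\<phi> x = ereal (real_of_ereal (\<phi> x))"
  using assms by (cases "\<phi> x") (auto simp: edom_def)

lemma Sset_subset_edom:
  assumes "x \<in> edom X \<phi>"
  shows "Sset X d le \<phi> x \<subseteq> edom X \<phi>"
proof
  fix y assume y: "y \<in> Sset X d le \<phi> x"
  then have "\<phi> y + ereal (d y x) < \<infinity>"
    using assms by (auto simp: Sset_def edom_def)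
  then have "\<phi> y < \<infinity>" by (cases "\<phi> y") auto
  with y show "y \<in> edom X \<phi>" by (simp add: edom_def Sset_def)
qed

text \<open>Each \<open>?S x\<close> contains \<open>x\<close>, and \<open>\<phi>\<close> is bounded
  below, so its infimum over \<open>?S x\<close> is a real number that some point of
  \<open>?S x\<close> nearly attains; dependent choice iterates this. The tolerance
  \<open>inverse (real (Suc n))\<close> only has to tend to 0. Comparing with every \<open>w\<close>
  instead of the infimum lets the limit argument work pointwise.\<close>

lemma (in preordered_quasi_metric_space) near_minimizing_sequence:
  assumes proper: "edom X \<phi> \<noteq> {}"
    and below: "\<And>x. x \<in> X \<Longrightarrow> ereal c \<le> \<phi> x"
  obtains s where "\<And>n. s n \<in> edom X \<phi>" "\<And>n. s (Suc n) \<in> Sset X d le \<phi> (s n)"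
    "\<And>n w. w \<in> Sset X d le \<phi> (s n) \<Longrightarrow>
      real_of_ereal (\<phi> (s (Suc n))) < real_of_ereal (\<phi> w) + inverse (real (Suc n))"
proof -
  let ?f = "\<lambda>x. real_of_ereal (\<phi> x)"
  let ?S = "Sset X d le \<phi>"
  have step: "\<exists>y. y \<in> edom X \<phi> \<and> (y \<in> ?S x \<and> (\<forall>w\<in>?S x. ?f y < ?f w + inverse (real (Suc n))))"
    if x: "x \<in> edom X \<phi>" for x n
  proof -
    have ne: "?f ` ?S x \<noteq> {}" using Sset_self x by (auto simp: edom_def)
    have "c \<le> ?f w" if "w \<in> ?S x" for w
      using below[of w] Sset_subset_edom[OF x] that
      by (cases "\<phi> w") (auto simp: edom_def Sset_def)
    then have bdd: "bdd_below (?f ` ?S x)" by (auto intro!: bdd_belowI)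
    obtain y where y: "y \<in> ?S x" "?f y < Inf (?f ` ?S x) + inverse (real (Suc n))"
      using cInf_lessD[OF ne, of "Inf (?f ` ?S x) + inverse (real (Suc n))"] by auto
    have "?f y < ?f w + inverse (real (Suc n))" if "w \<in> ?S x" for w
      using y(2) cINF_lower[OF bdd that] by simp
    then show ?thesis using y Sset_subset_edom[OF x] by blast
  qed
  have "\<exists>s. \<forall>n. s n \<in> edom X \<phi> \<and> (s (Suc n) \<in> ?S (s n) \<and>
      (\<forall>w\<in>?S (s n). ?f (s (Suc n)) < ?f w + inverse (real (Suc n))))"
    by (rule dependent_nat_choice) (use proper step in auto)
  then show ?thesis using that by blast
qed

lemma (in preordered_quasi_metric_space) Sset_seq_mono:
  assumes X: "\<And>n. s n \<in> X" and S: "\<And>n. s (Suc n) \<in> Sset X d le \<phi> (s n)" and "n \<le> m"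
  shows "s m \<in> Sset X d le \<phi> (s n)"
  using \<open>n \<le> m\<close>
proof (induction rule: dec_induct)
  case base
  show ?case by (rule Sset_self[OF X])
next
  case (step m)
  then show ?case using Sset_mono[OF X] S by blast
qed

lemma (in preordered_quasi_metric_space) ex_Sset_constant:
  assumes complete: "seq_incr_right_K_complete X d le"
    and proper: "edom X \<phi> \<noteq> {}"
    and below: "\<And>x. x \<in> X \<Longrightarrow> ereal c \<le> \<phi> x"
    and lsc: "incr_lsc X d le \<phi>"
    and upper: "\<And>s x. \<lbrakk>range s \<subseteq> X; x \<in> X; increasing_seq le s;
            limitin (qtopology X d) s x sequentially\<rbrakk> \<Longrightarrow> \<forall>n. le (s n) x"
  shows "\<exists>z\<in>edom X \<phi>. \<forall>y\<in>Sset X d le \<phi> z. \<phi> y = \<phi> z"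
proof -
  let ?S = "Sset X d le \<phi>"
  \<comment> \<open>\<open>real_of_ereal\<close> sends infinity to 0, so \<open>f\<close> is
    faithful only on \<open>edom X \<phi>\<close>. All points used below lie there, because
    \<open>?S x\<close> stays inside the domain when \<open>x\<close> does.\<close>
  define f where "f x = real_of_ereal (\<phi> x)" for x
  have fin: "\<phi> x \<noteq> -\<infinity>" if "x \<in> X" for x using below[OF that] by auto
  have f: "\<phi> x = ereal (f x)" if "x \<in> edom X \<phi>" for x
    unfolding f_def using that fin by (intro edom_eq_ereal) (auto simp: edom_def)
  have Sreal: "le x y \<and> f y + d y x \<le> f x" if "x \<in> edom X \<phi>" "y \<in> ?S x" for x y
  proof -
    have "y \<in> edom X \<phi>" using Sset_subset_edom[OF that(1)] that(2) by blast
    then show ?thesis using that by (simp add: Sset_def f)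
  qed
  obtain s where s: "\<And>n. s n \<in> edom X \<phi>" "\<And>n. s (Suc n) \<in> ?S (s n)"
    and near: "\<And>n w. w \<in> ?S (s n) \<Longrightarrow> f (s (Suc n)) < f w + inverse (real (Suc n))"
    using near_minimizing_sequence[OF proper below] unfolding f_def by metis
  have sX: "s n \<in> X" for n using s(1) by (simp add: edom_def)
  have range: "range s \<subseteq> X" using sX by blast
  have inc: "increasing_seq le s" using s(2) by (simp add: increasing_seq_def Sset_def)
  have dle: "d (s m) (s n) \<le> f (s n) - f (s m)" if "n \<le> m" for m n
    using Sreal[OF s(1) Sset_seq_mono[of s, OF sX s(2) that]] by simp
  have "decseq (\<lambda>n. f (s n))"
    using Sreal[OF s(1) s(2)] nonneg[OF sX sX]
    by (intro decseq_SucI) (smt (verit))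
  moreover have "c \<le> f (s n)" for n using below[OF sX, of n] f[OF s(1)] by simp
  ultimately obtain L where L: "(\<lambda>n. f (s n)) \<longlonglongrightarrow> L" and Lle: "\<And>n. L \<le> f (s n)"
    using decseq_convergent[of "\<lambda>n. f (s n)" c] by metis
  have "right_K_Cauchy d s"
    unfolding right_K_Cauchy_def
  proof (intro allI impI)
    fix e :: real assume "e > 0"
    then have "\<forall>\<^sub>F n in sequentially. f (s n) < L + e"
      using order_tendstoD(2)[OF L] by simp
    then obtain N where "\<And>n. n \<ge> N \<Longrightarrow> f (s n) < L + e"
      by (auto simp: eventually_sequentially)
    \<comment> \<open>For \<open>N \<le> n < m\<close>, the distance is at most
      \<open>f (s n) - f (s m)\<close>, which is below \<open>(L + e) - L\<close>.\<close>
    then show "\<exists>N. \<forall>n m. N \<le> n \<and> n < m \<longrightarrow> d (s m) (s n) < e"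
      using dle Lle by (intro exI[of _ N]) (smt (verit) less_imp_le)
  qed
  then obtain z where z: "limitin (qtopology X d) s z sequentially"
    using complete inc range unfolding seq_incr_right_K_complete_def by blast
  then have zX: "z \<in> X" and dz: "(\<lambda>n. d z (s n)) \<longlonglongrightarrow> 0"
    using limitin_qtopology[OF range] by auto
  have "\<phi> z \<le> liminf (\<lambda>n. \<phi> (s n))"
    using lsc range inc z unfolding incr_lsc_def by blast
  also have "\<dots> = ereal L"
    using L by (intro lim_imp_Liminf) (auto simp: f[OF s(1)])
  finally have zL: "\<phi> z \<le> ereal L" .
  then have zdom: "z \<in> edom X \<phi>" using zX by (auto simp: edom_def)
  have fz: "f z \<le> L" using zL f[OF zdom] by simp
  have zS: "z \<in> ?S (s n)" for n
  proof -
    \<comment> \<open>Let \<open>m\<close> tend to infinity in the triangle inequality through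
      \<open>s m\<close>; the term \<open>d z (s m)\<close> vanishes by convergence. Together with
      \<open>f z \<le> L\<close> this is the inequality required for
      \<open>z \<in> ?S (s n)\<close>.\<close>
    have "d z (s n) \<le> 0 + (f (s n) - L)"
    proof (rule tendsto_lowerbound)
      show "(\<lambda>m. d z (s m) + (f (s n) - f (s m))) \<longlonglongrightarrow> 0 + (f (s n) - L)"
        by (intro tendsto_intros dz L)
      show "\<forall>\<^sub>F m in sequentially. d z (s n) \<le> d z (s m) + (f (s n) - f (s m))"
        using eventually_ge_at_top[of n]
        by eventually_elim (use dle triangle[OF zX sX sX] in \<open>smt (verit)\<close>)
    qed simp
    then show ?thesis
      using upper[OF range zX inc z] fz zX by (simp add: Sset_def f[OF zdom] f[OF s(1)])
  qed
  have "\<phi> y = \<phi> z" if y: "y \<in> ?S z" for y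
  proof -
    \<comment> \<open>Since \<open>y\<close> lies in every \<open>?S (s n)\<close>, it may serve as
      \<open>w\<close> in \<open>near\<close>; passing to the limit removes the tolerance.\<close>
    have "L \<le> f y + 0"
    proof (rule LIMSEQ_le)
      show "(\<lambda>n. f (s (Suc n))) \<longlonglongrightarrow> L" using L by (rule LIMSEQ_Suc)
      show "(\<lambda>n. f y + inverse (real (Suc n))) \<longlonglongrightarrow> f y + 0"
        by (intro tendsto_intros LIMSEQ_inverse_real_of_nat)
      have "y \<in> ?S (s n)" for n using Sset_mono[OF sX zS] y by blast
      then show "\<exists>N. \<forall>n\<ge>N. f (s (Suc n)) \<le> f y + inverse (real (Suc n))"
        using near less_imp_le by blast
    qed
    moreover have "f y \<le> f z"
      using Sreal[OF zdom y] nonneg[of y z] zX y by (auto simp: Sset_def)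
    ultimately have "f y = f z" using fz by simp
    then show ?thesis using f zdom y Sset_subset_edom[OF zdom] by (metis subsetD)
  qed
  then show ?thesis using zdom by blast
qed

theorem theorem3p3:
  fixes X :: "'a set" and d :: "'a \<Rightarrow> 'a \<Rightarrow> real" and le :: "'a \<Rightarrow> 'a \<Rightarrow> bool"
    and \<phi> :: "'a \<Rightarrow> ereal"
  assumes "preordered_quasi_metric_space X d le"
    and "seq_incr_right_K_complete X d le"
    and "\<forall>x\<in>X. \<phi> x \<noteq> -\<infinity>"
    and "edom X \<phi> \<noteq> {}"
    and "\<exists>c::real. \<forall>x\<in>X. ereal c \<le> \<phi> x"
    and "incr_lsc X d le \<phi>"
    and "\<And>s x. \<lbrakk>range s \<subseteq> X; x \<in> X; increasing_seq le s;
            limitin (qtopology X d) s x sequentially\<rbrakk> \<Longrightarrow> \<forall>n. le (s n) x"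
  shows "(\<exists>z\<in>edom X \<phi>. \<forall>y\<in>Sset X d le \<phi> z. \<phi> y = \<phi> z) \<and>
         (\<forall>z\<in>edom X \<phi>. (\<forall>y\<in>Sset X d le \<phi> z. \<phi> y = \<phi> z) \<longrightarrow>
            (\<forall>y\<in>Sset X d le \<phi> z.
               Sset X d le \<phi> y \<subseteq> qtopology X d closure_of {y} \<and>
               (\<forall>x \<in> edom X \<phi> - Sset X d le \<phi> y. le y x \<longrightarrow> \<phi> y < \<phi> x + ereal (d x y)) \<and>
               (\<forall>x \<in> X - edom X \<phi>. \<phi> y < \<phi> x + ereal (d x y))))"
proof -
  interpret preordered_quasi_metric_space X d le by fact
  let ?S = "Sset X d le \<phi>"
  obtain c where "\<And>x. x \<in> X \<Longrightarrow> ereal c \<le> \<phi> x" using assms(5) by blast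
  then have "\<exists>z\<in>edom X \<phi>. \<forall>y\<in>?S z. \<phi> y = \<phi> z"
    using assms(2,4,6,7) by (intro ex_Sset_constant) auto
  \<comment> \<open>Any \<open>z\<close> with the constancy property is allowed here, not just the
    limit constructed above.\<close>
  moreover have "?S y \<subseteq> qtopology X d closure_of {y} \<and>
      (\<forall>x \<in> edom X \<phi> - ?S y. le y x \<longrightarrow> \<phi> y < \<phi> x + ereal (d x y)) \<and>
      (\<forall>x \<in> X - edom X \<phi>. \<phi> y < \<phi> x + ereal (d x y))"
    if z: "z \<in> edom X \<phi>" and const: "\<forall>y\<in>?S z. \<phi> y = \<phi> z" and y: "y \<in> ?S z" for z y
  proof (intro conjI ballI impI subsetI)
    have zX: "z \<in> X" using z by (simp add: edom_def)
    have yX: "y \<in> X" using y by (simp add: Sset_def)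
    have ydom: "y \<in> edom X \<phi>" using Sset_subset_edom[OF z] y by blast
    obtain r where r: "\<phi> y = ereal r" using edom_eq_ereal[OF ydom] assms(3) yX by metis
    {
      fix w assume w: "w \<in> ?S y"
      then have wX: "w \<in> X" by (simp add: Sset_def)
      have "w \<in> ?S z" using Sset_mono[OF zX y] w by blast
      then have "\<phi> w = \<phi> y" using const y by simp
      \<comment> \<open>The equal values \<open>\<phi> w\<close> and \<open>\<phi> y\<close> cancel
        in the inequality defining \<open>?S y\<close> because they are finite.\<close>
      then have "d w y \<le> 0" using w r by (simp add: Sset_def)
      then show "w \<in> qtopology X d closure_of {y}"
        using nonneg[OF wX yX] wX by (simp add: closure_of_singleton_qtopology[OF yX])
    next
      \<comment> \<open>Since \<open>x\<close> meets the order condition, it can only be outside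
        \<open>?S y\<close> by violating the inequality, and the negation is the strict
        claim.\<close>
      fix x assume "x \<in> edom X \<phi> - ?S y" "le y x"
      then show "\<phi> y < \<phi> x + ereal (d x y)" by (auto simp: Sset_def edom_def)
    next
      fix x assume "x \<in> X - edom X \<phi>"
      then show "\<phi> y < \<phi> x + ereal (d x y)" by (simp add: edom_def r)
    }
  qed
  ultimately show ?thesis by blast
qed

end
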